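(* Let $\mathcal{I}$ be a tall ideal on $\omega$ and let $X$ be a topological space of cardinality less than $\mathrm{cov}^*(\mathcal{I})$. Then $X$ is an $\mathcal{I}$wQN-space if and only if it is a wQN-space.
   Context: An ideal on $\omega$ is a proper subfamily of $\mathcal{P}(\omega)$ closed under finite unions and subsets and containing all finite sets; $\mathrm{Fin}$ is the ideal of finite sets. An ideal $\mathcal I$ on $\omega$ is tall if every infinite subset of $\omega$ contains an infinite member of $\mathcal I$. For tall $\mathcal I$, $\mathrm{cov}^*(\mathcal I)$ is the minimal cardinality of a family $\mathcal A\subseteq\mathcal I$ such that for every infinite $S\subseteq\omega$ there is $A\in\mathcal A$ with $A\cap S$ infinite. A sequence of reals $(x_n)$ is $\mathcal I$-convergent to $x$ if $\{n:|x_n-x|\ge\varepsilon\}\in\mathcal I$ for all $\varepsilon>0$. A sequence $(f_n)\subseteq\mathbb R^X$ $\mathcal I$QN-converges to $f\in\mathbb R^X$ if there are positive reals $\varepsilon_n$, with $(\varepsilon_n)$ $\mathcal I$-convergent to $0$, such that $\{n:|f_n(x)-f(x)|\ge\varepsilon_n\}\in\mathcal I$ for each $x\in X$. For infinite $B\subseteq\omega$, $e_B:\omega\to B$ is its increasing enumeration. A topological space $X$ is an $\mathcal I$wQN-space if for every sequence of continuous functions $f_n:X\to\mathbb R$ converging pointwise to $0$ there is an infinite $B\subseteq\omega$ such that $(f_{e_B(n)})_n$ $\mathcal I$QN-converges to $0$. A wQN-space is a $\mathrm{Fin}$wQN-space. *)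

theory Defs
  imports "HOL-Analysis.Analysis" "HOL-Library.Infinite_Set"
begin

definition omega_ideal :: "nat set set \<Rightarrow> bool" where
  "omega_ideal I \<longleftrightarrow>
     UNIV \<notin> I \<and>
     (\<forall>A\<in>I. \<forall>B\<in>I. A \<union> B \<in> I) \<and>
     (\<forall>A\<in>I. \<forall>B. B \<subseteq> A \<longrightarrow> B \<in> I) \<and>
     (\<forall>A. finite A \<longrightarrow> A \<in> I)"

definition Fin_ideal :: "nat set set" where
  "Fin_ideal = {A. finite A}"

definition tall :: "nat set set \<Rightarrow> bool" where
  "tall I \<longleftrightarrow> (\<forall>S. infinite S \<longrightarrow> (\<exists>A\<in>I. infinite A \<and> A \<subseteq> S))"

definition star_covering :: "nat set set \<Rightarrow> nat set set \<Rightarrow> bool" where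
  "star_covering I F \<longleftrightarrow>
     F \<subseteq> I \<and> (\<forall>S. infinite S \<longrightarrow> (\<exists>A\<in>F. infinite (A \<inter> S)))"

text \<open>
  The cardinal is represented, as in the library's theory of cardinals, by a
  cardinal order: that of a covering family of least cardinality. It is determined
  only up to order isomorphism, and it is meaningful only for tall \<open>I\<close>, where such
  a family exists (lemma \<open>cov_star_minimal\<close>).
\<close>

definition cov_star :: "nat set set \<Rightarrow> nat set rel" where
  "cov_star I =
     (SOME \<kappa>. \<exists>F. star_covering I F \<and> \<kappa> = card_of F \<and>
        (\<forall>G. star_covering I G \<longrightarrow> (\<kappa>, card_of G) \<in> ordLeq))"

lemma cov_star_minimal:
  assumes "tall I"
  shows "\<exists>F. star_covering I F \<and> cov_star I = card_of F"
    and "\<And>G. star_covering I G \<Longrightarrow> (cov_star I, card_of G) \<in> ordLeq"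
proof -
  have "star_covering I I"
    using assms unfolding star_covering_def tall_def by (metis inf.absorb1 subset_refl)
  then have "card_of ` Collect (star_covering I) \<noteq> {}"
    by blast
  then have "\<exists>r\<in>card_of ` Collect (star_covering I).
      \<forall>r'\<in>card_of ` Collect (star_covering I). (r, r') \<in> ordLeq"
    by (intro exists_minim_Card_order) (auto simp: card_of_Card_order)
  then have "\<exists>\<kappa> F. star_covering I F \<and> \<kappa> = card_of F \<and>
        (\<forall>G. star_covering I G \<longrightarrow> (\<kappa>, card_of G) \<in> ordLeq)"
    by auto
  from someI_ex[OF this] show "\<exists>F. star_covering I F \<and> cov_star I = card_of F"
    and "\<And>G. star_covering I G \<Longrightarrow> (cov_star I, card_of G) \<in> ordLeq"
    unfolding cov_star_def by blast+
qed

definition ideal_convergent :: "nat set set \<Rightarrow> (nat \<Rightarrow> real) \<Rightarrow> real \<Rightarrow> bool" where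
  "ideal_convergent I x l \<longleftrightarrow> (\<forall>\<epsilon>>0. {n. \<bar>x n - l\<bar> \<ge> \<epsilon>} \<in> I)"

text \<open>
  The set \<open>S\<close> is the common domain of the functions; their values outside \<open>S\<close> play
  no role.
\<close>

definition ideal_QN_convergent ::
    "nat set set \<Rightarrow> 'a set \<Rightarrow> (nat \<Rightarrow> 'a \<Rightarrow> real) \<Rightarrow> ('a \<Rightarrow> real) \<Rightarrow> bool" where
  "ideal_QN_convergent I S f g \<longleftrightarrow>
     (\<exists>\<epsilon>. (\<forall>n. \<epsilon> n > 0) \<and> ideal_convergent I \<epsilon> 0 \<and>
          (\<forall>x\<in>S. {n. \<bar>f n x - g x\<bar> \<ge> \<epsilon> n} \<in> I))"

definition ideal_wQN_space :: "nat set set \<Rightarrow> 'a topology \<Rightarrow> bool" where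
  "ideal_wQN_space I X \<longleftrightarrow>
     (\<forall>f :: nat \<Rightarrow> 'a \<Rightarrow> real.
        (\<forall>n. continuous_map X euclideanreal (f n)) \<and>
        (\<forall>x\<in>topspace X. (\<lambda>n. f n x) \<longlonglongrightarrow> 0)
        \<longrightarrow> (\<exists>B. infinite B \<and>
               ideal_QN_convergent I (topspace X) (\<lambda>n. f (enumerate B n)) (\<lambda>x. 0)))"

definition wQN_space :: "'a topology \<Rightarrow> bool" where
  "wQN_space X \<longleftrightarrow> ideal_wQN_space Fin_ideal X"

end

(*
  Quasinormal convergence modulo I, witnessed by eps, is governed by the exceptional
  sets {n. |f n x| \<ge> eps n}, one for each point x, and the countably many sets
  {n. eps n \<ge> 1/(k+1)}, all of them members of I. There are fewer than cov*(I) of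
  them altogether: cov*(I) is uncountable, because a diagonal choice yields an infinite
  set almost disjoint from each of countably many members of I. Hence some infinite S
  is almost disjoint from all the exceptional sets, and along S the convergence is
  quasinormal modulo Fin. The converse holds because Fin is contained in I.
*)

theory Submission
  imports Defs
begin

text \<open>Properness of \<open>I\<close> drives the diagonal choice: a finite union of members of
  \<open>F\<close>, enlarged by an initial segment of the naturals, still lies in \<open>I\<close>,
  so arbitrarily large points lie outside it.\<close>

lemma countable_subset_ideal_almost_disjoint:
  assumes I: "omega_ideal I" and "F \<subseteq> I" "countable F"
  shows "\<exists>S. infinite S \<and> (\<forall>A\<in>F. finite (A \<inter> S))"
proof (cases "F = {}")
  case True
  then show ?thesis using infinite_UNIV_nat by blast
next
  case False
  define A where "A = from_nat_into F"
  have rangeA: "range A = F"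
    unfolding A_def using False assms(3) by (rule range_from_nat_into)
  have UnA: "(\<Union>i\<le>n. A i) \<in> I" for n
    using I rangeA assms(2) by (induction n) (auto simp: atMost_Suc omega_ideal_def)
  have avoid: "\<exists>k>m. \<forall>i\<le>n. k \<notin> A i" for m n
  proof (rule ccontr)
    assume "\<not> ?thesis"
    then have "k \<in> (\<Union>i\<le>n. A i) \<union> {..m}" for k
      by (cases "k \<le> m") (auto simp: not_le)
    then have "UNIV = (\<Union>i\<le>n. A i) \<union> {..m}"
      by blast
    moreover have "(\<Union>i\<le>n. A i) \<union> {..m} \<in> I"
      using I UnA unfolding omega_ideal_def by simp
    ultimately show False
      using I unfolding omega_ideal_def by simp
  qed
  have "\<exists>s. \<forall>n. (\<forall>i\<le>n. s n \<notin> A i) \<and> s n < s (Suc n)"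
  proof (rule dependent_nat_choice)
    show "\<exists>k. \<forall>i\<le>0. k \<notin> A i"
      using avoid[of 0 0] by blast
    show "\<exists>k'. (\<forall>i\<le>Suc n. k' \<notin> A i) \<and> k < k'" for k n
      using avoid[of k "Suc n"] by blast
  qed
  then obtain s where s: "\<And>n. \<forall>i\<le>n. s n \<notin> A i" "\<And>n. s n < s (Suc n)"
    by auto
  have "strict_mono s"
    using s(2) by (simp add: strict_mono_Suc_iff)
  then have "infinite (range s)"
    by (simp add: strict_mono_imp_inj_on range_inj_infinite)
  \<comment> \<open>The point \<open>s n\<close> avoids \<open>A i\<close> as soon as
    \<open>n\<close> reaches \<open>i\<close>, so only the first \<open>i\<close> chosen points can
    lie in \<open>A i\<close>.\<close>
  moreover have "A i \<inter> range s \<subseteq> s ` {..<i}" for i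
  proof
    fix y assume "y \<in> A i \<inter> range s"
    then obtain n where n: "y = s n" "s n \<in> A i" by blast
    then have "n < i"
      using s(1)[of n] not_le by blast
    with n(1) show "y \<in> s ` {..<i}" by simp
  qed
  then have "finite (A i \<inter> range s)" for i
    by (rule finite_subset) simp
  ultimately show ?thesis using rangeA by blast
qed

text \<open>For infinite \<open>T\<close> the countable part \<open>C\<close> is absorbed and the
  family has at most |\<open>T\<close>| members, too few to cover. For finite \<open>T\<close> the
  family is countable, and the diagonal choice applies.\<close>

lemma not_star_covering_image_Un_countable:
  assumes I: "omega_ideal I" and "tall I"
    and less: "(card_of T, cov_star I) \<in> ordLess"
    and "countable C"
  shows "\<not> star_covering I (a ` T \<union> C)"
proof
  assume cov: "star_covering I (a ` T \<union> C)"
  show False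
  proof (cases "finite T")
    case True
    then have "countable (a ` T \<union> C)"
      using assms(4) by (simp add: countable_finite)
    moreover have "a ` T \<union> C \<subseteq> I"
      using cov unfolding star_covering_def by blast
    ultimately obtain S where "infinite S" "\<forall>A\<in>a ` T \<union> C. finite (A \<inter> S)"
      using countable_subset_ideal_almost_disjoint[OF I] by blast
    with cov show False
      unfolding star_covering_def by blast
  next
    case False
    have "(card_of C, card_of (UNIV :: nat set)) \<in> ordLeq"
      using assms(4) unfolding countable_def card_of_ordLeq[symmetric] by simp
    moreover have "(card_of (UNIV :: nat set), card_of T) \<in> ordLeq"
      using False by (simp add: infinite_iff_card_of_nat)
    ultimately have "(card_of C, card_of T) \<in> ordLeq"
      by (rule ordLeq_transitive)
    then have "(card_of (a ` T \<union> C), card_of T) \<in> ordLeq"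
      using False card_of_Un_ordLeq_infinite_Field[OF _ card_of_image _ card_of_Card_order]
      by (simp add: Field_card_of)
    then have "(cov_star I, card_of T) \<in> ordLeq"
      using cov_star_minimal(2)[OF assms(2) cov] by (rule ordLeq_transitive[rotated])
    with less show False
      using not_ordLess_ordLeq by blast
  qed
qed

lemma ideal_QN_convergent_mono:
  assumes "I \<subseteq> J" "ideal_QN_convergent I S f g"
  shows "ideal_QN_convergent J S f g"
  using assms unfolding ideal_QN_convergent_def ideal_convergent_def by (meson subsetD)

text \<open>Thinning produces an increasing sequence of indices, whereas
  \<open>ideal_wQN_space\<close> asks for an infinite set; this identity translates between the
  two.\<close>

lemma enumerate_range_strict_mono:
  fixes r :: "nat \<Rightarrow> nat"
  assumes "strict_mono r"
  shows "enumerate (range r) = r"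
proof
  have inf: "infinite (range r)"
    using assms by (intro range_inj_infinite strict_mono_imp_inj_on)
  show "enumerate (range r) n = r n" for n
  proof (induction n)
    case 0
    show ?case
      unfolding enumerate_0 using strict_mono_less_eq[OF assms]
      by (intro Least_equality) auto
  next
    case (Suc n)
    show ?case
      unfolding enumerate_Suc''[OF inf] Suc.IH
      using strict_mono_less[OF assms] strict_mono_less_eq[OF assms]
      by (intro Least_equality) auto
  qed
qed

lemma ideal_QN_convergent_subseq:
  assumes "omega_ideal I" "tall I" "(card_of T, cov_star I) \<in> ordLess"
    and "ideal_QN_convergent I T f g"
  shows "\<exists>r. strict_mono r \<and> ideal_QN_convergent Fin_ideal T (f \<circ> r) g"
proof -
  obtain \<epsilon> where pos: "\<And>n. \<epsilon> n > 0" and conv: "ideal_convergent I \<epsilon> 0"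
    and A: "\<And>x. x \<in> T \<Longrightarrow> {n. \<bar>f n x - g x\<bar> \<ge> \<epsilon> n} \<in> I"
    using assms(4) unfolding ideal_QN_convergent_def by blast
  define a where "a x = {n. \<bar>f n x - g x\<bar> \<ge> \<epsilon> n}" for x
  \<comment> \<open>By the Archimedean property, these countably many thresholds capture the
    convergence of \<open>\<epsilon>\<close> to 0.\<close>
  define c where "c k = {n. \<bar>\<epsilon> n\<bar> \<ge> inverse (Suc k)}" for k
  \<comment> \<open>As \<open>star_covering\<close> also requires membership in \<open>I\<close>,
    this inclusion is what turns its failure into an infinite \<open>S\<close> almost disjoint from
    every \<open>a x\<close> and every \<open>c k\<close>.\<close>
  have "a ` T \<union> range c \<subseteq> I"
    using A conv unfolding a_def c_def ideal_convergent_def by auto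
  with not_star_covering_image_Un_countable[OF assms(1-3), of "range c" a]
  obtain S where S: "infinite S" "\<And>x. x \<in> T \<Longrightarrow> finite (a x \<inter> S)" "\<And>k. finite (c k \<inter> S)"
    unfolding star_covering_def by auto
  define r where "r = enumerate S"
  have r: "strict_mono r" "range r = S"
    using S(1) by (simp_all add: r_def strict_mono_enumerate range_enumerate)
  \<comment> \<open>Since \<open>r\<close> is injective with range \<open>S\<close>, a set almost
    disjoint from \<open>S\<close> has a finite preimage under \<open>r\<close>. The control
    sequence \<open>\<epsilon> \<circ> r\<close> therefore works modulo
    \<open>Fin_ideal\<close>.\<close>
  have fin: "finite {n. r n \<in> B}" if "finite (B \<inter> S)" for B
  proof -
    have "{n. r n \<in> B} = r -` (B \<inter> S)"
      using r(2) by auto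
    then show ?thesis
      using finite_vimageI[OF that strict_mono_imp_inj_on[OF r(1)]] by simp
  qed
  have "ideal_convergent Fin_ideal (\<epsilon> \<circ> r) 0"
    unfolding ideal_convergent_def
  proof (intro allI impI)
    fix e :: real assume "e > 0"
    then obtain k where k: "inverse (Suc k) < e"
      using reals_Archimedean by blast
    have "{n. \<bar>(\<epsilon> \<circ> r) n - 0\<bar> \<ge> e} \<subseteq> {n. r n \<in> c k}"
      using k by (auto simp: c_def)
    then show "{n. \<bar>(\<epsilon> \<circ> r) n - 0\<bar> \<ge> e} \<in> Fin_ideal"
      using fin[OF S(3)] finite_subset unfolding Fin_ideal_def by blast
  qed
  moreover have "{n. \<bar>(f \<circ> r) n x - g x\<bar> \<ge> (\<epsilon> \<circ> r) n} \<in> Fin_ideal" if "x \<in> T" for x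
    using fin[OF S(2)[OF that]] by (simp add: a_def Fin_ideal_def)
  ultimately have "ideal_QN_convergent Fin_ideal T (f \<circ> r) g"
    unfolding ideal_QN_convergent_def using pos by (intro exI[of _ "\<epsilon> \<circ> r"]) auto
  with r(1) show ?thesis by blast
qed

theorem corollary3p3:
  fixes I :: "nat set set" and X :: "'a topology"
  assumes "omega_ideal I" and "tall I"
    and "(card_of (topspace X), cov_star I) \<in> ordLess"
  shows "ideal_wQN_space I X \<longleftrightarrow> wQN_space X"
proof
  have "Fin_ideal \<subseteq> I"
    using assms(1) unfolding Fin_ideal_def omega_ideal_def by blast
  \<comment> \<open>The same \<open>B\<close> serves for both ideals.\<close>
  then show "wQN_space X \<Longrightarrow> ideal_wQN_space I X"
    unfolding wQN_space_def ideal_wQN_space_def by (meson ideal_QN_convergent_mono)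
next
  assume wQN: "ideal_wQN_space I X"
  show "wQN_space X"
    unfolding wQN_space_def ideal_wQN_space_def
  proof (intro allI impI)
    fix f :: "nat \<Rightarrow> 'a \<Rightarrow> real"
    assume "(\<forall>n. continuous_map X euclideanreal (f n)) \<and>
        (\<forall>x\<in>topspace X. (\<lambda>n. f n x) \<longlonglongrightarrow> 0)"
    with wQN obtain B where B: "infinite B"
      "ideal_QN_convergent I (topspace X) (\<lambda>n. f (enumerate B n)) (\<lambda>x. 0)"
      unfolding ideal_wQN_space_def by blast
    obtain r where r: "strict_mono r"
      "ideal_QN_convergent Fin_ideal (topspace X) ((\<lambda>n. f (enumerate B n)) \<circ> r) (\<lambda>x. 0)"
      using ideal_QN_convergent_subseq[OF assms B(2)] by blast
    \<comment> \<open>The new witness is the subset of \<open>B\<close> picked out by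
      \<open>r\<close>; its increasing enumeration is this composite.\<close>
    have mono: "strict_mono (enumerate B \<circ> r)"
      using B(1) r(1) by (simp add: strict_mono_o strict_mono_enumerate)
    have "infinite (range (enumerate B \<circ> r))"
      using mono by (intro range_inj_infinite strict_mono_imp_inj_on)
    moreover have "ideal_QN_convergent Fin_ideal (topspace X)
        (\<lambda>n. f (enumerate (range (enumerate B \<circ> r)) n)) (\<lambda>x. 0)"
      using r(2) unfolding enumerate_range_strict_mono[OF mono] by (simp add: comp_def)
    ultimately show "\<exists>B. infinite B \<and> ideal_QN_convergent Fin_ideal (topspace X)
        (\<lambda>n. f (enumerate B n)) (\<lambda>x. 0)"
      by blast
  qed
qed

end
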